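(* Let $\sigma$ be a universal sentence in the language of groups and let $n$ be a positive integer. Then the set of marked groups $(G,S)\in\mathcal{G}_n$ such that $G$ satisfies $\sigma$ is closed in $\mathcal{G}_n$. Equivalently, if a sequence of marked groups $(G_i,S_i)$ converges to a marked group $(G,S)$ in $\mathcal{G}_n$, then $\mathrm{Univ}(G)\supset\limsup_i \mathrm{Univ}(G_i)$.
   Context: A marked group $(G,S)$ is a group $G$ with an ordered finite generating family $S=(s_1,\dots,s_n)$ (repetitions allowed); two marked groups are identified if $s_i\mapsto s_i'$ extends to a group isomorphism. $\mathcal{G}_n$ is the set of groups marked by $n$ elements, identified with the set of normal subgroups of the free group $F_n=\langle e_1,\dots,e_n\rangle$ (kernel of $e_i\mapsto s_i$), with the topology induced by the product topology on $2^{F_n}$. A universal sentence is a first-order sentence that can be written $\forall x_1\dots\forall x_p\,\phi(x_1,\dots,x_p)$ with $\phi$ quantifier-free in the language of groups $(\cdot,{}^{-1},1,=)$. $\mathrm{Univ}(G)$ is the set of universal sentences satisfied by $G$. $\limsup_i \mathrm{Univ}(G_i)=\bigcap_{k}\bigcup_{i\ge k}\mathrm{Univ}(G_i)$. *)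

theory Defs
  imports "HOL-Algebra.Algebra" "HOL-Analysis.Analysis"
begin

section \<open>First-order formulas in the language of groups\<close>

datatype group_term =
    Var nat
  | One
  | Inv group_term
  | Mult group_term group_term

datatype group_formula =
    Eq group_term group_term
  | Neg group_formula
  | Conj group_formula group_formula
  | Disj group_formula group_formula
  | All nat group_formula
  | Ex nat group_formula

primrec term_vars :: "group_term \<Rightarrow> nat set" where
  "term_vars (Var x) = {x}"
| "term_vars One = {}"
| "term_vars (Inv t) = term_vars t"
| "term_vars (Mult t u) = term_vars t \<union> term_vars u"

primrec free_vars :: "group_formula \<Rightarrow> nat set" where
  "free_vars (Eq t u) = term_vars t \<union> term_vars u"
| "free_vars (Neg \<phi>) = free_vars \<phi>"
| "free_vars (Conj \<phi> \<psi>) = free_vars \<phi> \<union> free_vars \<psi>"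
| "free_vars (Disj \<phi> \<psi>) = free_vars \<phi> \<union> free_vars \<psi>"
| "free_vars (All x \<phi>) = free_vars \<phi> - {x}"
| "free_vars (Ex x \<phi>) = free_vars \<phi> - {x}"

definition sentence :: "group_formula \<Rightarrow> bool" where
  "sentence \<phi> \<longleftrightarrow> free_vars \<phi> = {}"

primrec quantifier_free :: "group_formula \<Rightarrow> bool" where
  "quantifier_free (Eq t u) \<longleftrightarrow> True"
| "quantifier_free (Neg \<phi>) \<longleftrightarrow> quantifier_free \<phi>"
| "quantifier_free (Conj \<phi> \<psi>) \<longleftrightarrow> quantifier_free \<phi> \<and> quantifier_free \<psi>"
| "quantifier_free (Disj \<phi> \<psi>) \<longleftrightarrow> quantifier_free \<phi> \<and> quantifier_free \<psi>"
| "quantifier_free (All x \<phi>) \<longleftrightarrow> False"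
| "quantifier_free (Ex x \<phi>) \<longleftrightarrow> False"

primrec term_val :: "('a, 'm) monoid_scheme \<Rightarrow> (nat \<Rightarrow> 'a) \<Rightarrow> group_term \<Rightarrow> 'a" where
  "term_val G e (Var x) = e x"
| "term_val G e One = \<one>\<^bsub>G\<^esub>"
| "term_val G e (Inv t) = inv\<^bsub>G\<^esub> (term_val G e t)"
| "term_val G e (Mult t u) = term_val G e t \<otimes>\<^bsub>G\<^esub> term_val G e u"

primrec sat :: "('a, 'm) monoid_scheme \<Rightarrow> (nat \<Rightarrow> 'a) \<Rightarrow> group_formula \<Rightarrow> bool" where
  "sat G e (Eq t u) \<longleftrightarrow> term_val G e t = term_val G e u"
| "sat G e (Neg \<phi>) \<longleftrightarrow> \<not> sat G e \<phi>"
| "sat G e (Conj \<phi> \<psi>) \<longleftrightarrow> sat G e \<phi> \<and> sat G e \<psi>"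
| "sat G e (Disj \<phi> \<psi>) \<longleftrightarrow> sat G e \<phi> \<or> sat G e \<psi>"
| "sat G e (All x \<phi>) \<longleftrightarrow> (\<forall>a\<in>carrier G. sat G (e(x := a)) \<phi>)"
| "sat G e (Ex x \<phi>) \<longleftrightarrow> (\<exists>a\<in>carrier G. sat G (e(x := a)) \<phi>)"

text \<open>For a sentence, the value of \<open>sat\<close> does not depend on the assignment; see \<open>models_sentence\<close> below.\<close>

definition models :: "('a, 'm) monoid_scheme \<Rightarrow> group_formula \<Rightarrow> bool" where
  "models G \<sigma> \<longleftrightarrow> (\<forall>e. range e \<subseteq> carrier G \<longrightarrow> sat G e \<sigma>)"

text \<open>
  A universal sentence is a sentence that \<open>can be written\<close> \<open>\<forall>x\<^sub>1 \<dots> \<forall>x\<^sub>p. \<phi>\<close> with \<open>\<phi>\<close> quantifier-free,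
  i.e. one that holds in the same groups as a sentence literally of that form.  A HOL definition cannot
  quantify over all types, so equivalence is tested on the groups whose carrier is a subset of
  \<open>nat\<close>, which up to isomorphism are the countable ones (see \<open>models_equivalent_countable\<close> below).
  By the downward Loewenheim-Skolem theorem this is the same as equivalence over all groups.
\<close>

definition universal_prenex :: "group_formula \<Rightarrow> bool" where
  "universal_prenex \<phi> \<longleftrightarrow> (\<exists>xs \<psi>. quantifier_free \<psi> \<and> \<phi> = foldr All xs \<psi>)"

definition group_equivalent :: "group_formula \<Rightarrow> group_formula \<Rightarrow> bool" where
  "group_equivalent \<sigma> \<tau> \<longleftrightarrow> (\<forall>G :: nat monoid. group G \<longrightarrow> (models G \<sigma> \<longleftrightarrow> models G \<tau>))"

definition universal_sentence :: "group_formula \<Rightarrow> bool" where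
  "universal_sentence \<sigma> \<longleftrightarrow>
     sentence \<sigma> \<and> (\<exists>\<tau>. sentence \<tau> \<and> universal_prenex \<tau> \<and> group_equivalent \<sigma> \<tau>)"

definition Univ :: "('a, 'm) monoid_scheme \<Rightarrow> group_formula set" where
  "Univ G = {\<sigma>. universal_sentence \<sigma> \<and> models G \<sigma>}"


section \<open>The free group on n generators\<close>

text \<open>
  The letter \<open>(i, True)\<close> stands for the generator \<open>e\<^sub>i\<close> and \<open>(i, False)\<close> for its inverse, with \<open>i\<close>
  ranging over \<open>0, \<dots>, n - 1\<close>.  The elements of the free group are the reduced words.
\<close>

type_synonym letter = "nat \<times> bool"

definition inv_letter :: "letter \<Rightarrow> letter" where
  "inv_letter a = (fst a, \<not> snd a)"

definition push :: "letter \<Rightarrow> letter list \<Rightarrow> letter list" where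
  "push a w = (case w of [] \<Rightarrow> [a] | b # w' \<Rightarrow> if b = inv_letter a then w' else a # w)"

fun reduced :: "letter list \<Rightarrow> bool" where
  "reduced (a # b # w) \<longleftrightarrow> b \<noteq> inv_letter a \<and> reduced (b # w)"
| "reduced w \<longleftrightarrow> True"

definition free_group :: "nat \<Rightarrow> letter list monoid" where
  "free_group n =
     \<lparr>carrier = {w. reduced w \<and> fst ` set w \<subseteq> {..<n}},
      monoid.mult = \<lambda>u v. foldr push u v,
      one = []\<rparr>"


section \<open>The space of marked groups\<close>

definition marked_group :: "nat \<Rightarrow> ('a, 'm) monoid_scheme \<Rightarrow> 'a list \<Rightarrow> bool" where
  "marked_group n G S \<longleftrightarrow>
     group G \<and> length S = n \<and> set S \<subseteq> carrier G \<and> generate G (set S) = carrier G"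

definition letter_val :: "('a, 'm) monoid_scheme \<Rightarrow> 'a list \<Rightarrow> letter \<Rightarrow> 'a" where
  "letter_val G S a = (if snd a then S ! fst a else inv\<^bsub>G\<^esub> (S ! fst a))"

definition word_val :: "('a, 'm) monoid_scheme \<Rightarrow> 'a list \<Rightarrow> letter list \<Rightarrow> 'a" where
  "word_val G S w = foldr (\<lambda>a g. letter_val G S a \<otimes>\<^bsub>G\<^esub> g) w \<one>\<^bsub>G\<^esub>"

definition marking_kernel :: "('a, 'm) monoid_scheme \<Rightarrow> 'a list \<Rightarrow> letter list set" where
  "marking_kernel G S = kernel (free_group (length S)) G (word_val G S)"

text \<open>
  The points of the space are the normal subgroups \<open>N\<close> of the free group, \<open>N\<close> standing for the
  marked group \<open>free_group n Mod N\<close>; the topology is induced by the product topology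
  on \<open>{False, True}\<close>-valued functions on the free group via indicator functions.
\<close>

definition marked_group_space :: "nat \<Rightarrow> letter list set topology" where
  "marked_group_space n =
     pullback_topology {N. N \<lhd> free_group n}
       (\<lambda>N. \<lambda>w\<in>carrier (free_group n). w \<in> N)
       (product_topology (\<lambda>_. discrete_topology (UNIV :: bool set)) (carrier (free_group n)))"


section \<open>Basic facts\<close>

lemma term_val_cong:
  "(\<And>x. x \<in> term_vars t \<Longrightarrow> e x = e' x) \<Longrightarrow> term_val G e t = term_val G e' t"
  by (induction t) auto

lemma sat_cong:
  "(\<And>x. x \<in> free_vars \<phi> \<Longrightarrow> e x = e' x) \<Longrightarrow> sat G e \<phi> \<longleftrightarrow> sat G e' \<phi>"
proof (induction \<phi> arbitrary: e e')
  case (Eq t u)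
  then show ?case using term_val_cong[of t e e' G] term_val_cong[of u e e' G] by simp
next
  case (Neg \<phi>)
  then show ?case by (metis free_vars.simps(2) sat.simps(2))
next
  case (Conj \<phi>1 \<phi>2)
  then show ?case by (metis UnI1 UnI2 free_vars.simps(3) sat.simps(3))
next
  case (Disj \<phi>1 \<phi>2)
  then show ?case by (metis UnI1 UnI2 free_vars.simps(4) sat.simps(4))
next
  case (All x \<phi>)
  have "sat G (e(x := a)) \<phi> \<longleftrightarrow> sat G (e'(x := a)) \<phi>" for a
    by (rule All.IH) (use All.prems in auto)
  then show ?case by simp
next
  case (Ex x \<phi>)
  have "sat G (e(x := a)) \<phi> \<longleftrightarrow> sat G (e'(x := a)) \<phi>" for a
    by (rule Ex.IH) (use Ex.prems in auto)
  then show ?case by simp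
qed

lemma models_sentence:
  assumes "sentence \<sigma>" "range e \<subseteq> carrier G"
  shows "models G \<sigma> \<longleftrightarrow> sat G e \<sigma>"
proof -
  have "sat G e' \<sigma> \<longleftrightarrow> sat G e \<sigma>" for e'
    by (rule sat_cong) (use assms(1) in \<open>simp add: sentence_def\<close>)
  then show ?thesis using assms(2) by (auto simp only: models_def)
qed

lemma term_val_closed:
  assumes "group G" "range e \<subseteq> carrier G"
  shows "term_val G e t \<in> carrier G"
proof -
  interpret group G by fact
  show ?thesis using assms(2) by (induction t) auto
qed

lemma term_val_hom:
  assumes "group_hom G H h" "range e \<subseteq> carrier G"
  shows "term_val H (h \<circ> e) t = h (term_val G e t)"
proof -
  interpret group_hom G H h by fact
  have "term_val G e t \<in> carrier G" for t
    using term_val_closed[OF G.group_axioms assms(2)] .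
  then show ?thesis by (induction t) auto
qed

lemma sat_iso:
  assumes "group_hom G H h" "bij_betw h (carrier G) (carrier H)" "range e \<subseteq> carrier G"
  shows "sat H (h \<circ> e) \<phi> \<longleftrightarrow> sat G e \<phi>"
  using assms(3)
proof (induction \<phi> arbitrary: e)
  case (Eq t u)
  interpret group_hom G H h by fact
  show ?case
    unfolding sat.simps term_val_hom[OF assms(1) Eq]
    by (rule inj_on_eq_iff[OF bij_betw_imp_inj_on[OF assms(2)]]) (rule term_val_closed[OF G.group_axioms Eq])+
next
  case (All x \<phi>)
  have upd: "sat H ((h \<circ> e)(x := h a)) \<phi> \<longleftrightarrow> sat G (e(x := a)) \<phi>" if "a \<in> carrier G" for a
  proof -
    have "range (e(x := a)) \<subseteq> carrier G" using All.prems that by auto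
    from All.IH[OF this] show ?thesis by (simp only: fun_upd_comp)
  qed
  have "carrier H = h ` carrier G" using assms(2) by (simp add: bij_betw_def)
  moreover have "(\<forall>a\<in>h ` A. P a) \<longleftrightarrow> (\<forall>a\<in>A. P (h a))" for A P by blast
  ultimately have "sat H (h \<circ> e) (All x \<phi>) \<longleftrightarrow> (\<forall>a\<in>carrier G. sat H ((h \<circ> e)(x := h a)) \<phi>)"
    by (simp only: sat.simps)
  also have "\<dots> \<longleftrightarrow> (\<forall>a\<in>carrier G. sat G (e(x := a)) \<phi>)"
    by (rule ball_cong[OF refl upd])
  finally show ?case by (simp only: sat.simps)
next
  case (Ex x \<phi>)
  have upd: "sat H ((h \<circ> e)(x := h a)) \<phi> \<longleftrightarrow> sat G (e(x := a)) \<phi>" if "a \<in> carrier G" for a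
  proof -
    have "range (e(x := a)) \<subseteq> carrier G" using Ex.prems that by auto
    from Ex.IH[OF this] show ?thesis by (simp only: fun_upd_comp)
  qed
  have "carrier H = h ` carrier G" using assms(2) by (simp add: bij_betw_def)
  moreover have "(\<exists>a\<in>h ` A. P a) \<longleftrightarrow> (\<exists>a\<in>A. P (h a))" for A P by blast
  ultimately have "sat H (h \<circ> e) (Ex x \<phi>) \<longleftrightarrow> (\<exists>a\<in>carrier G. sat H ((h \<circ> e)(x := h a)) \<phi>)"
    by (simp only: sat.simps)
  also have "\<dots> \<longleftrightarrow> (\<exists>a\<in>carrier G. sat G (e(x := a)) \<phi>)"
    by (rule bex_cong[OF refl upd])
  finally show ?case by (simp only: sat.simps)
next
  case (Neg \<phi>)
  show ?case unfolding sat.simps Neg.IH[OF Neg.prems] by (rule refl)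
next
  case (Conj \<phi> \<psi>)
  show ?case unfolding sat.simps Conj.IH(1)[OF Conj.prems] Conj.IH(2)[OF Conj.prems] by (rule refl)
next
  case (Disj \<phi> \<psi>)
  show ?case unfolding sat.simps Disj.IH(1)[OF Disj.prems] Disj.IH(2)[OF Disj.prems] by (rule refl)
qed

lemma models_iso:
  assumes "group G" "group H" "h \<in> iso G H" "sentence \<sigma>"
  shows "models G \<sigma> \<longleftrightarrow> models H \<sigma>"
proof -
  have hom: "group_hom G H h" and bij: "bij_betw h (carrier G) (carrier H)"
    using assms by (auto simp: iso_def group_hom_def group_hom_axioms_def)
  have one: "\<one>\<^bsub>G\<^esub> \<in> carrier G" using assms(1) by (simp add: group.is_monoid monoid.one_closed)
  define e where "e = (\<lambda>_::nat. \<one>\<^bsub>G\<^esub>)"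
  have e: "range e \<subseteq> carrier G" using one by (auto simp: e_def)
  then have he: "range (h \<circ> e) \<subseteq> carrier H" using bij by (auto simp: bij_betw_def)
  show ?thesis
    unfolding models_sentence[OF assms(4) e] models_sentence[OF assms(4) he] sat_iso[OF hom bij e]
    by (rule refl)
qed

lemma models_equivalent_countable:
  assumes eq: "group_equivalent \<sigma> \<tau>" and "sentence \<sigma>" "sentence \<tau>"
    and G: "group G" "countable (carrier G)"
  shows "models G \<sigma> \<longleftrightarrow> models G \<tau>"
proof -
  interpret group G by fact
  obtain f :: "'a \<Rightarrow> nat" where f: "inj_on f (carrier G)"
    using G(2) by (auto simp: countable_def)
  define g where "g = inv_into (carrier G) f"
  define H :: "nat monoid" where
    "H = \<lparr>carrier = f ` carrier G, monoid.mult = \<lambda>x y. f (g x \<otimes>\<^bsub>G\<^esub> g y), one = f \<one>\<^bsub>G\<^esub>\<rparr>"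
  have gf: "g (f x) = x" if "x \<in> carrier G" for x
    using that f by (simp add: g_def)
  have iso: "f \<in> iso G H"
    using f by (auto simp: iso_def hom_def bij_betw_def H_def gf)
  have "group H"
  proof (rule groupI)
    fix x assume "x \<in> carrier H"
    then obtain a where "a \<in> carrier G" "x = f a" by (auto simp: H_def)
    then show "\<exists>y\<in>carrier H. y \<otimes>\<^bsub>H\<^esub> x = \<one>\<^bsub>H\<^esub>"
      by (intro bexI[of _ "f (inv\<^bsub>G\<^esub> a)"]) (auto simp: H_def gf)
  qed (auto simp: H_def gf m_assoc)
  moreover from this have "models H \<sigma> \<longleftrightarrow> models H \<tau>"
    using eq by (simp add: group_equivalent_def)
  ultimately show ?thesis
    using models_iso[OF G(1) _ iso assms(2)] models_iso[OF G(1) _ iso assms(3)] by simp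
qed

lemma inv_letter_inv_letter [simp]: "inv_letter (inv_letter a) = a"
  by (simp add: inv_letter_def)

lemma fst_inv_letter [simp]: "fst (inv_letter a) = fst a"
  by (simp add: inv_letter_def)

lemma inv_letter_neq [simp]: "inv_letter a \<noteq> a" "a \<noteq> inv_letter a"
  by (auto simp: inv_letter_def prod_eq_iff)

lemma reduced_tl: "reduced (a # w) \<Longrightarrow> reduced w"
  by (cases w) auto

lemma reduced_push: "reduced w \<Longrightarrow> reduced (push a w)"
  by (cases w) (auto simp: push_def dest: reduced_tl)

lemma push_inv: "reduced w \<Longrightarrow> push a (push (inv_letter a) w) = w"
  by (cases w rule: reduced.cases) (auto simp: push_def)

lemma push_Cons: "reduced (a # w) \<Longrightarrow> push a w = a # w"
  by (cases w) (auto simp: push_def)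

lemma reduced_foldr_push: "reduced v \<Longrightarrow> reduced (foldr push u v)"
  by (induction u) (auto simp: reduced_push)

lemma set_push: "set (push a w) \<subseteq> insert a (set w)"
  by (auto simp: push_def split: list.splits if_splits)

lemma set_foldr_push: "set (foldr push u v) \<subseteq> set u \<union> set v"
proof (induction u)
  case (Cons a u)
  then show ?case using set_push[of a "foldr push u v"] by auto
qed simp

lemma foldr_push_push:
  assumes "reduced w"
  shows "foldr push (push a x) w = push a (foldr push x w)"
proof (cases x)
  case (Cons b y)
  have "reduced (foldr push y w)" using assms by (rule reduced_foldr_push)
  then show ?thesis using Cons by (auto simp: push_def[of a "b # y"] push_inv)
qed (simp add: push_def)

lemma foldr_push_assoc:
  assumes "reduced w"
  shows "foldr push (foldr push u v) w = foldr push u (foldr push v w)"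
  by (induction u) (simp_all add: foldr_push_push[OF assms])

lemma foldr_push_Nil: "reduced w \<Longrightarrow> foldr push w [] = w"
proof (induction w)
  case (Cons a w)
  then show ?case using push_Cons[OF Cons.prems] reduced_tl[OF Cons.prems] by simp
qed simp

lemma foldr_push_inverse:
  assumes "reduced v"
  shows "foldr push (rev (map inv_letter u)) (foldr push u v) = v"
  using assms
proof (induction u arbitrary: v)
  case (Cons a u)
  have "push (inv_letter a) (push a (foldr push u v)) = foldr push u v"
    using push_inv[of "foldr push u v" "inv_letter a"] reduced_foldr_push[OF Cons.prems] by simp
  then show ?case using Cons by simp
qed simp

lemma group_free_group: "group (free_group n)"
proof (rule groupI)
  fix w assume "w \<in> carrier (free_group n)"
  then have w: "reduced w" "fst ` set w \<subseteq> {..<n}" by (auto simp: free_group_def)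
  define v where "v = foldr push (rev (map inv_letter w)) []"
  have "foldr push v w = foldr push (rev (map inv_letter w)) (foldr push [] w)"
    unfolding v_def by (rule foldr_push_assoc) fact
  also have "\<dots> = foldr push (rev (map inv_letter w)) (foldr push w [])"
    by (simp add: foldr_push_Nil w)
  also have "\<dots> = []" by (rule foldr_push_inverse) simp
  finally have "foldr push v w = []" .
  moreover have "reduced v" unfolding v_def by (rule reduced_foldr_push) simp
  moreover have "fst ` set v \<subseteq> {..<n}"
  proof -
    have "set v \<subseteq> inv_letter ` set w"
      using set_foldr_push[of "rev (map inv_letter w)" "[]"] by (simp add: v_def)
    then show ?thesis using w(2) by fastforce
  qed
  ultimately show "\<exists>v\<in>carrier (free_group n). v \<otimes>\<^bsub>free_group n\<^esub> w = \<one>\<^bsub>free_group n\<^esub>"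
    by (auto simp: free_group_def)
next
  fix u v assume "u \<in> carrier (free_group n)" "v \<in> carrier (free_group n)"
  then show "u \<otimes>\<^bsub>free_group n\<^esub> v \<in> carrier (free_group n)"
    using set_foldr_push[of u v] by (fastforce simp: free_group_def reduced_foldr_push)
qed (auto simp: free_group_def foldr_push_assoc)

lemma letter_val_closed:
  assumes "group G" "set S \<subseteq> carrier G" "fst a < length S"
  shows "letter_val G S a \<in> carrier G"
proof -
  interpret group G by fact
  have "S ! fst a \<in> carrier G" using assms by (meson nth_mem subsetD)
  then show ?thesis by (simp add: letter_val_def)
qed

lemma word_val_closed:
  assumes "group G" "set S \<subseteq> carrier G" "fst ` set w \<subseteq> {..<length S}"
  shows "word_val G S w \<in> carrier G"
proof -
  interpret group G by fact
  show ?thesis using assms(3)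
    by (induction w) (auto simp: word_val_def intro!: m_closed letter_val_closed assms(1,2))
qed

lemma word_val_push:
  assumes "group G" "set S \<subseteq> carrier G" "fst a < length S" "fst ` set w \<subseteq> {..<length S}"
  shows "word_val G S (push a w) = letter_val G S a \<otimes>\<^bsub>G\<^esub> word_val G S w"
proof -
  interpret group G by fact
  have a: "S ! fst a \<in> carrier G" using assms by (meson nth_mem subsetD)
  have canc: "letter_val G S a \<otimes>\<^bsub>G\<^esub> (letter_val G S (inv_letter a) \<otimes>\<^bsub>G\<^esub> g) = g"
    if "g \<in> carrier G" for g
    using a that by (auto simp: letter_val_def inv_letter_def m_assoc[symmetric])
  show ?thesis
  proof (cases w)
    case (Cons b v)
    have "word_val G S v \<in> carrier G"
      using assms Cons by (intro word_val_closed) auto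
    then show ?thesis using Cons canc by (auto simp: push_def word_val_def)
  qed (simp add: push_def word_val_def)
qed

lemma word_val_hom:
  assumes "marked_group n G S"
  shows "group_hom (free_group n) G (word_val G S)"
proof -
  have G: "group G" and n: "length S = n" and S: "set S \<subseteq> carrier G"
    using assms by (auto simp: marked_group_def)
  interpret group G by fact
  have "word_val G S (foldr push u v) = word_val G S u \<otimes>\<^bsub>G\<^esub> word_val G S v"
    if "fst ` set u \<subseteq> {..<n}" "fst ` set v \<subseteq> {..<n}" for u v
    using that
  proof (induction u)
    case Nil
    then show ?case using word_val_closed[OF G S, of v] n by (simp add: word_val_def)
  next
    case (Cons a u)
    have c: "fst ` set (foldr push u v) \<subseteq> {..<length S}"
      using set_foldr_push[of u v] Cons.prems n by fastforce
    have "word_val G S (push a (foldr push u v))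
        = letter_val G S a \<otimes>\<^bsub>G\<^esub> (word_val G S u \<otimes>\<^bsub>G\<^esub> word_val G S v)"
      using word_val_push[OF G S _ c, of a] Cons n by simp
    also have "\<dots> = (letter_val G S a \<otimes>\<^bsub>G\<^esub> word_val G S u) \<otimes>\<^bsub>G\<^esub> word_val G S v"
      using letter_val_closed[OF G S, of a] word_val_closed[OF G S] Cons.prems n
      by (simp add: m_assoc)
    finally show ?case by (simp add: word_val_def)
  qed
  then have "word_val G S \<in> hom (free_group n) G"
    using word_val_closed[OF G S] n by (auto simp: hom_def free_group_def)
  then show ?thesis
    using G group_free_group by (simp add: group_hom_def group_hom_axioms_def)
qed

lemma word_val_generator:
  assumes "marked_group n G S" "i < n"
  shows "[(i, True)] \<in> carrier (free_group n)" "word_val G S [(i, True)] = S ! i"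
proof -
  have "group G" "S ! i \<in> carrier G" using assms by (auto simp: marked_group_def)
  then show "word_val G S [(i, True)] = S ! i"
    by (simp add: word_val_def letter_val_def group.is_monoid monoid.r_one)
qed (use assms in \<open>simp add: free_group_def\<close>)

lemma word_val_surj:
  assumes "marked_group n G S"
  shows "word_val G S ` carrier (free_group n) = carrier G"
proof -
  interpret group_hom "free_group n" G "word_val G S" using assms by (rule word_val_hom)
  have "set S \<subseteq> word_val G S ` carrier (free_group n)"
  proof
    fix s assume "s \<in> set S"
    then obtain i where "i < n" "s = S ! i"
      using assms by (auto simp: marked_group_def in_set_conv_nth)
    then show "s \<in> word_val G S ` carrier (free_group n)"
      using word_val_generator[OF assms, of i] by (metis imageI)
  qed
  then have "generate G (set S) \<subseteq> word_val G S ` carrier (free_group n)"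
    by (rule H.generate_subgroup_incl[OF _ img_is_subgroup])
  then show ?thesis using assms by (auto simp: marked_group_def)
qed

lemma topspace_marked_group_space: "topspace (marked_group_space n) = {N. N \<lhd> free_group n}"
  by (auto simp: marked_group_space_def topspace_pullback_topology)

text \<open>
  The identification of marked groups with normal subgroups of the free group: \<open>(G, S)\<close> corresponds
  to the quotient of the free group by its marking kernel, and satisfies the same sentences as that
  quotient; two marked groups have the same kernel iff \<open>s\<^sub>i \<mapsto> s'\<^sub>i\<close> extends to an isomorphism; and
  every normal subgroup is the kernel of its quotient.
\<close>

lemma marking_kernel_in_space:
  assumes "marked_group n G S"
  shows "marking_kernel G S \<in> topspace (marked_group_space n)"
proof -
  interpret group_hom "free_group n" G "word_val G S" using assms by (rule word_val_hom)
  show ?thesis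
    using normal_kernel assms
    by (simp add: topspace_marked_group_space marking_kernel_def marked_group_def)
qed

lemma models_marking_kernel:
  assumes "marked_group n G S" "sentence \<sigma>"
  shows "models (free_group n Mod marking_kernel G S) \<sigma> \<longleftrightarrow> models G \<sigma>"
proof -
  interpret group_hom "free_group n" G "word_val G S" using assms(1) by (rule word_val_hom)
  have n: "length S = n" using assms by (simp add: marked_group_def)
  have "(\<lambda>U. the_elem (word_val G S ` U)) \<in> iso (free_group n Mod marking_kernel G S) G"
    using FactGroup_iso_set[OF word_val_surj[OF assms(1)]] by (simp add: marking_kernel_def n)
  moreover have "group (free_group n Mod marking_kernel G S)"
    using normal.factorgroup_is_group[OF normal_kernel] by (simp add: marking_kernel_def n)
  ultimately show ?thesis using models_iso[OF _ H.group_axioms _ assms(2)] by blast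
qed

lemma word_val_generate:
  assumes "group G" "set S \<subseteq> carrier G" "fst ` set w \<subseteq> {..<length S}"
  shows "word_val G S w \<in> generate G (set S)"
proof -
  interpret group G by fact
  have "letter_val G S a \<in> generate G (set S)" if "fst a < length S" for a
    using that by (auto simp: letter_val_def intro: generate.intros)
  then show ?thesis using assms(3)
    by (induction w) (auto simp: word_val_def intro: generate.intros)
qed

lemma marked_group_quotient:
  assumes N: "N \<lhd> free_group n"
  defines "S \<equiv> map (\<lambda>i. N #>\<^bsub>free_group n\<^esub> [(i, True)]) [0..<n]"
  shows "marked_group n (free_group n Mod N) S" "marking_kernel (free_group n Mod N) S = N"
proof -
  interpret normal N "free_group n" by fact
  define Q where "Q = free_group n Mod N"
  define \<pi> where "\<pi> = (\<lambda>w. N #>\<^bsub>free_group n\<^esub> w)"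
  have Q: "group Q" unfolding Q_def by (rule factorgroup_is_group)
  interpret \<pi>: group_hom "free_group n" Q \<pi>
    using Q r_coset_hom_Mod unfolding Q_def \<pi>_def
    by (simp add: group_hom_def group_hom_axioms_def is_group)
  have len: "length S = n" by (simp add: S_def)
  have e: "[a] \<in> carrier (free_group n)" if "fst a < n" for a
    using that by (simp add: free_group_def)
  have Si: "S ! i = \<pi> [(i, True)]" if "i < n" for i
    using that by (simp add: S_def \<pi>_def)
  have S: "set S \<subseteq> carrier Q"
    using \<pi>.hom_closed[OF e] by (auto simp: S_def \<pi>_def[symmetric])
  have lv: "letter_val Q S a = \<pi> [a]" if a: "fst a < n" for a
  proof (cases "snd a")
    case True
    then have "a = (fst a, True)" by (simp add: prod_eq_iff)
    then show ?thesis using Si[OF a] by (metis True letter_val_def)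
  next
    case False
    then have eq: "a = (fst a, False)" by (metis (full_types) prod.collapse)
    have "[a] \<otimes>\<^bsub>free_group n\<^esub> [(fst a, True)] = \<one>\<^bsub>free_group n\<^esub>"
      using False by (simp add: free_group_def push_def inv_letter_def prod_eq_iff)
    then have "inv\<^bsub>free_group n\<^esub> [(fst a, True)] = [a]"
      using e a by (intro inv_equality) auto
    then have "\<pi> [a] = inv\<^bsub>Q\<^esub> (\<pi> [(fst a, True)])"
      using \<pi>.hom_inv[OF e[of "(fst a, True)"]] a by simp
    then show ?thesis using Si[OF a] False by (simp add: letter_val_def)
  qed
  have wv: "word_val Q S w = \<pi> w" if "w \<in> carrier (free_group n)" for w
    using that
  proof (induction w)
    case Nil
    then show ?case using \<pi>.hom_one by (simp add: word_val_def free_group_def)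
  next
    case (Cons a w)
    have red: "reduced (a # w)" and a: "fst a < n" and w: "w \<in> carrier (free_group n)"
      using Cons.prems by (auto simp: free_group_def dest: reduced_tl)
    have "a # w = [a] \<otimes>\<^bsub>free_group n\<^esub> w"
      using push_Cons[OF red] by (simp add: free_group_def)
    then have "\<pi> (a # w) = \<pi> [a] \<otimes>\<^bsub>Q\<^esub> \<pi> w"
      using \<pi>.hom_mult[OF e[OF a] w] by simp
    then show ?case using Cons.IH[OF w] lv[OF a] by (simp add: word_val_def)
  qed
  have "carrier Q \<subseteq> generate Q (set S)"
  proof
    fix x assume "x \<in> carrier Q"
    then obtain w where w: "w \<in> carrier (free_group n)" "x = \<pi> w"
      by (auto simp: Q_def \<pi>_def FactGroup_def RCOSETS_def)
    then show "x \<in> generate Q (set S)"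
      using word_val_generate[OF Q S, of w] wv[of w] len by (auto simp: free_group_def)
  qed
  moreover have "generate Q (set S) \<subseteq> carrier Q"
    using group.generate_incl[OF Q S] .
  ultimately show "marked_group n (free_group n Mod N) S"
    using Q S len by (auto simp: marked_group_def Q_def)
  have "w \<in> N \<longleftrightarrow> \<pi> w = \<one>\<^bsub>Q\<^esub>" if "w \<in> carrier (free_group n)" for w
    using that coset_join1[of N w] rcos_const[of w] subset is_group subgroup_axioms
    by (auto simp: \<pi>_def Q_def FactGroup_def)
  then show "marking_kernel (free_group n Mod N) S = N"
    using subset wv by (auto simp: marking_kernel_def kernel_def len Q_def)
qed

lemma marking_kernel_eq_iff:
  assumes G: "marked_group n G S" and H: "marked_group n H T"
  shows "marking_kernel G S = marking_kernel H T \<longleftrightarrow> (\<exists>h\<in>iso G H. map h S = T)"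
proof
  let ?F = "free_group n" and ?g = "word_val G S" and ?h = "word_val H T"
  interpret g: group_hom ?F G ?g using G by (rule word_val_hom)
  interpret h: group_hom ?F H ?h using H by (rule word_val_hom)
  have len: "length S = n" "length T = n" using G H by (auto simp: marked_group_def)
  show "\<exists>h\<in>iso G H. map h S = T" if ker: "marking_kernel G S = marking_kernel H T"
  proof -
    have "?g u = ?g v \<longleftrightarrow> ?h u = ?h v" if uv: "u \<in> carrier ?F" "v \<in> carrier ?F" for u v
    proof -
      have "?g u = ?g v \<longleftrightarrow> u \<otimes>\<^bsub>?F\<^esub> inv\<^bsub>?F\<^esub> v \<in> kernel ?F G ?g"
        using uv by (auto simp: kernel_def g.H.inv_solve_right' )
      moreover have "?h u = ?h v \<longleftrightarrow> u \<otimes>\<^bsub>?F\<^esub> inv\<^bsub>?F\<^esub> v \<in> kernel ?F H ?h"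
        using uv by (auto simp: kernel_def h.H.inv_solve_right')
      ultimately show ?thesis using ker by (simp add: marking_kernel_def len)
    qed
    note eq = this
    define k where "k = (\<lambda>x. ?h (inv_into (carrier ?F) ?g x))"
    have surj: "?g ` carrier ?F = carrier G" "?h ` carrier ?F = carrier H"
      using word_val_surj[OF G] word_val_surj[OF H] by auto
    have k: "k (?g w) = ?h w" if "w \<in> carrier ?F" for w
    proof -
      have "?g w \<in> ?g ` carrier ?F" using that by (rule imageI)
      note inv_into_into[OF this] f_inv_into_f[OF this]
      then show ?thesis using eq[OF _ that] by (simp only: k_def)
    qed
    have "k \<in> hom G H"
    proof (rule homI)
      fix x assume "x \<in> carrier G"
      then obtain u where u: "u \<in> carrier ?F" "x = ?g u"
        unfolding surj(1)[symmetric] by (rule imageE)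
      show "k x \<in> carrier H" unfolding u(2) k[OF u(1)] using u(1) by (rule h.hom_closed)
      fix y assume "y \<in> carrier G"
      then obtain v where v: "v \<in> carrier ?F" "y = ?g v"
        unfolding surj(1)[symmetric] by (rule imageE)
      have uv: "u \<otimes>\<^bsub>?F\<^esub> v \<in> carrier ?F" using u(1) v(1) by (rule g.G.m_closed)
      show "k (x \<otimes>\<^bsub>G\<^esub> y) = k x \<otimes>\<^bsub>H\<^esub> k y"
        unfolding u(2) v(2) k[OF u(1)] k[OF v(1)] g.hom_mult[OF u(1) v(1), symmetric] k[OF uv]
        by (rule h.hom_mult[OF u(1) v(1)])
    qed
    moreover have "inj_on k (carrier G)"
    proof (rule inj_onI)
      fix x y assume xy: "x \<in> carrier G" "y \<in> carrier G" "k x = k y"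
      obtain u where u: "u \<in> carrier ?F" "x = ?g u"
        using xy(1) unfolding surj(1)[symmetric] by (rule imageE)
      obtain v where v: "v \<in> carrier ?F" "y = ?g v"
        using xy(2) unfolding surj(1)[symmetric] by (rule imageE)
      show "x = y"
        using xy(3) unfolding u(2) v(2) k[OF u(1)] k[OF v(1)] eq[OF u(1) v(1)] .
    qed
    moreover have "k ` carrier G = carrier H"
    proof -
      have "k ` carrier G = (\<lambda>w. k (?g w)) ` carrier ?F"
        unfolding surj(1)[symmetric] by (rule image_image)
      also have "\<dots> = ?h ` carrier ?F" using k by (intro image_cong) auto
      finally show ?thesis unfolding surj(2) .
    qed
    ultimately have "k \<in> iso G H" by (simp add: iso_def bij_betw_def)
    moreover have "map k S = T"
    proof (rule nth_equalityI)
      fix i assume "i < length (map k S)"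
      then have i: "i < n" "i < length S" using len by simp_all
      show "map k S ! i = T ! i"
        using k[OF word_val_generator(1)[OF G i(1)]]
        unfolding nth_map[OF i(2)] word_val_generator(2)[OF G i(1)] word_val_generator(2)[OF H i(1)] .
    qed (simp add: len)
    ultimately show ?thesis by blast
  qed
  show "marking_kernel G S = marking_kernel H T" if "\<exists>h\<in>iso G H. map h S = T"
  proof -
    obtain k where k: "k \<in> iso G H" "map k S = T" using \<open>\<exists>h\<in>iso G H. map h S = T\<close> by blast
    interpret k: group_hom G H k
      using k by (simp add: group_hom_def group_hom_axioms_def g.H.is_group h.H.is_group iso_def)
    have S: "set S \<subseteq> carrier G" using G by (simp add: marked_group_def)
    have "?h w = k (?g w)" if "fst ` set w \<subseteq> {..<n}" for w
      using that
    proof (induction w)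
      case (Cons a w)
      have "S ! fst a \<in> carrier G" "T ! fst a = k (S ! fst a)"
        using S Cons.prems len k(2) by auto
      then have "letter_val H T a = k (letter_val G S a)"
        by (simp add: letter_val_def)
      then show ?case
        using Cons len letter_val_closed[OF g.H.is_group S, of a]
          word_val_closed[OF g.H.is_group S, of w]
        by (simp add: word_val_def)
    qed (simp add: word_val_def)
    moreover have "k x = \<one>\<^bsub>H\<^esub> \<longleftrightarrow> x = \<one>\<^bsub>G\<^esub>" if "x \<in> carrier G" for x
    proof -
      have "inj_on k (carrier G)" using k(1) by (simp add: iso_def bij_betw_def)
      from inj_on_eq_iff[OF this that g.H.one_closed] show ?thesis by simp
    qed
    ultimately show ?thesis
      using word_val_closed[OF g.H.is_group S]
      by (auto simp: marking_kernel_def kernel_def len free_group_def)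
  qed
qed

end

theory Submission
  imports Defs
begin

text \<open>
  Lifting assignments in a quotient of the free group \<open>F\<close> by \<open>N\<close> to assignments in \<open>F\<close>, a prenex
  universal sentence with matrix \<open>\<psi>\<close> holds in the quotient iff \<open>\<psi>\<close> holds under every assignment
  lifted to \<open>F\<close>.  For a fixed lift, each equation in \<open>\<psi>\<close> says that one fixed word lies in \<open>N\<close>, so
  the truth of \<open>\<psi>\<close> defines a clopen set of \<open>N\<close>; the models of the sentence form an intersection of
  such sets.
\<close>

text \<open>\<open>models\<close> already quantifies over all assignments, so it tests the universal
  closure. This lets a universal prefix be dropped even when the matrix has free variables.\<close>

lemma models_All: "models G (All x \<phi>) \<longleftrightarrow> models G \<phi>"
proof
  assume all: "models G (All x \<phi>)"
  show "models G \<phi>"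
    unfolding models_def
  proof (intro allI impI)
    fix e :: "nat \<Rightarrow> _" assume e: "range e \<subseteq> carrier G"
    \<comment> \<open>The quantifier is instantiated at the current value \<open>e x\<close>.
      \<open>fun_upd_triv\<close> is switched off so that the update does not collapse before it
      matches.\<close>
    then have "sat G (e(x := e x)) \<phi>"
      using all by (auto simp: models_def simp del: fun_upd_triv)
    then show "sat G e \<phi>" by simp
  qed
next
  assume \<phi>: "models G \<phi>"
  have "range (e(x := a)) \<subseteq> carrier G" if "range e \<subseteq> carrier G" "a \<in> carrier G"
    for e :: "nat \<Rightarrow> _" and a
    using that by auto
  then show "models G (All x \<phi>)" using \<phi> by (simp add: models_def)
qed

lemma models_foldr_All: "models G (foldr All xs \<phi>) \<longleftrightarrow> models G \<phi>"
  by (induction xs) (simp_all add: models_All)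

text \<open>Choosing preimages pointwise shows that every assignment into \<open>H\<close> has the
  form \<open>h \<circ> e\<close>. It is applied to the projection of the free group onto a
  quotient.\<close>

lemma models_surj_hom:
  assumes "h ` carrier G = carrier H"
  shows "models H \<phi> \<longleftrightarrow> (\<forall>e. range e \<subseteq> carrier G \<longrightarrow> sat H (h \<circ> e) \<phi>)"
proof
  assume "models H \<phi>"
  moreover have "range (h \<circ> e) \<subseteq> carrier H" if "range e \<subseteq> carrier G" for e
    using that assms by auto
  ultimately show "\<forall>e. range e \<subseteq> carrier G \<longrightarrow> sat H (h \<circ> e) \<phi>"
    by (simp only: models_def) blast
next
  assume *: "\<forall>e. range e \<subseteq> carrier G \<longrightarrow> sat H (h \<circ> e) \<phi>"
  show "models H \<phi>"
    unfolding models_def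
  proof (intro allI impI)
    fix e :: "nat \<Rightarrow> _" assume "range e \<subseteq> carrier H"
    then have e: "e x \<in> h ` carrier G" for x using assms by blast
    define e' where "e' = inv_into (carrier G) h \<circ> e"
    have "h \<circ> e' = e" using f_inv_into_f[OF e] by (auto simp: e'_def)
    moreover have "range e' \<subseteq> carrier G" using inv_into_into[OF e] by (auto simp: e'_def)
    ultimately show "sat H e \<phi>" using * by metis
  qed
qed

text \<open>Cosets that share an element coincide. An equation in the quotient thus becomes
  membership of an element that does not depend on the subgroup.\<close>

lemma (in normal) r_coset_eq_iff:
  assumes "x \<in> carrier G" "y \<in> carrier G"
  shows "H #> x = H #> y \<longleftrightarrow> x \<otimes> inv y \<in> H"
proof
  assume eq: "H #> x = H #> y"
  have "x \<in> H #> y" using rcos_self[OF assms(1) subgroup_axioms] eq by simp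
  then show "x \<otimes> inv y \<in> H" using rcos_module_imp[OF is_group assms(2)] by blast
next
  assume "x \<otimes> inv y \<in> H"
  then have "x \<in> H #> y" by (rule rcos_module_rev[OF is_group assms(2,1)])
  then show "H #> x = H #> y" using repr_independence[OF _ assms(2) subgroup_axioms] by simp
qed

lemma (in normal) group_hom_r_coset: "group_hom G (G Mod H) (\<lambda>x. H #> x)"
  using factorgroup_is_group r_coset_hom_Mod
  by (simp add: group_hom_def group_hom_axioms_def is_group)

lemma carrier_Mod: "carrier (G Mod H) = (\<lambda>x. H #>\<^bsub>G\<^esub> x) ` carrier G"
  by (auto simp: FactGroup_def RCOSETS_def)

text \<open>Membership of a fixed word is a coordinate of the indicator map, hence continuous into a
  discrete space; the set is the preimage of the clopen \<open>{True}\<close>.\<close>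

lemma clopen_mem_marked_group_space:
  assumes "w \<in> carrier (free_group n)"
  shows "openin (marked_group_space n) {N \<in> topspace (marked_group_space n). w \<in> N}"
    and "closedin (marked_group_space n) {N \<in> topspace (marked_group_space n). w \<in> N}"
proof -
  let ?X = "marked_group_space n" and ?F = "carrier (free_group n)"
  let ?P = "product_topology (\<lambda>_. discrete_topology (UNIV :: bool set)) ?F"
  \<comment> \<open>Composing with \<open>id\<close> gives the shape that the pullback rule
    expects.\<close>
  have "continuous_map ?X ?P (id \<circ> (\<lambda>N. \<lambda>w\<in>?F. w \<in> N))"
    unfolding marked_group_space_def by (rule continuous_map_pullback[OF continuous_map_id])
  from continuous_map_componentwise[THEN iffD1, OF this] assms
  have c: "continuous_map ?X (discrete_topology UNIV) (\<lambda>N. w \<in> N)" by simp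
  show "openin ?X {N \<in> topspace ?X. w \<in> N}"
    using openin_continuous_map_preimage[OF c, of "{True}"] by simp
  show "closedin ?X {N \<in> topspace ?X. w \<in> N}"
    using closedin_continuous_map_preimage[OF c, of "{True}"] by simp
qed

text \<open>By induction on the formula. Openness and closedness are carried together because
  negation exchanges them.\<close>

lemma clopen_sat_quotient:
  assumes "quantifier_free \<psi>" and e: "range e \<subseteq> carrier (free_group n)"
  defines "S \<equiv> {N \<in> topspace (marked_group_space n).
    sat (free_group n Mod N) ((\<lambda>w. N #>\<^bsub>free_group n\<^esub> w) \<circ> e) \<psi>}"
  shows "openin (marked_group_space n) S \<and> closedin (marked_group_space n) S"
  using assms(1) unfolding S_def
proof (induction \<psi>)
  case (Eq t u)
  interpret F: group "free_group n" by (rule group_free_group)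
  let ?t = "term_val (free_group n) e t" and ?u = "term_val (free_group n) e u"
  let ?w = "?t \<otimes>\<^bsub>free_group n\<^esub> inv\<^bsub>free_group n\<^esub> ?u"
  have tu: "?t \<in> carrier (free_group n)" "?u \<in> carrier (free_group n)"
    using term_val_closed[OF group_free_group e] by auto
  have "sat (free_group n Mod N) ((\<lambda>w. N #>\<^bsub>free_group n\<^esub> w) \<circ> e) (Eq t u) \<longleftrightarrow> ?w \<in> N"
    if "N \<in> topspace (marked_group_space n)" for N
  proof -
    \<comment> \<open>The projection is a homomorphism, so each side of the equation evaluates to
      the coset of its value in the free group.\<close>
    interpret normal N "free_group n" using that by (simp add: topspace_marked_group_space)
    show ?thesis
      unfolding sat.simps term_val_hom[OF group_hom_r_coset e] by (rule r_coset_eq_iff[OF tu])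
  qed
  then have "{N \<in> topspace (marked_group_space n).
      sat (free_group n Mod N) ((\<lambda>w. N #>\<^bsub>free_group n\<^esub> w) \<circ> e) (Eq t u)} =
    {N \<in> topspace (marked_group_space n). ?w \<in> N}" by blast
  moreover have "?w \<in> carrier (free_group n)" using tu by simp
  ultimately show ?case using clopen_mem_marked_group_space[of ?w n] by (simp only: simp_thms)
next
  case (Neg \<phi>)
  let ?X = "marked_group_space n"
  have "{N \<in> topspace ?X. \<not> P N} = topspace ?X - {N \<in> topspace ?X. P N}" for P by blast
  then show ?case using Neg by (simp add: openin_diff closedin_diff)
next
  case (Conj \<phi> \<psi>)
  then show ?case by (simp add: openin_Int closedin_Int Collect_conj_eq2)
next
  case (Disj \<phi> \<psi>)
  let ?X = "marked_group_space n"
  have "{N \<in> topspace ?X. P N \<or> Q N} = {N \<in> topspace ?X. P N} \<union> {N \<in> topspace ?X. Q N}" for P Q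
    by blast
  then show ?case using Disj by (simp add: openin_Un closedin_Un)
qed simp_all

text \<open>There may be infinitely many lifted assignments, so of the clopen sets only closedness
  survives the intersection.\<close>

lemma closedin_models_quantifier_free:
  assumes "quantifier_free \<psi>"
  shows "closedin (marked_group_space n)
    {N \<in> topspace (marked_group_space n). models (free_group n Mod N) \<psi>}"
proof -
  let ?X = "marked_group_space n" and ?A = "{e :: nat \<Rightarrow> _. range e \<subseteq> carrier (free_group n)}"
  let ?S = "\<lambda>e. {N \<in> topspace ?X.
    sat (free_group n Mod N) ((\<lambda>w. N #>\<^bsub>free_group n\<^esub> w) \<circ> e) \<psi>}"
  \<comment> \<open>The constant assignment makes the index set nonempty, as
    \<open>closedin_Inter\<close> requires; it also keeps the intersection inside the space.\<close>
  have "(\<lambda>_. \<one>\<^bsub>free_group n\<^esub>) \<in> ?A"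
    using group.is_monoid[OF group_free_group] by (auto simp: monoid.one_closed)
  then have "?A \<noteq> {}" by blast
  then have "closedin ?X (\<Inter>e\<in>?A. ?S e)"
    using clopen_sat_quotient[OF assms] by (intro closedin_Inter) auto
  also have "(\<Inter>e\<in>?A. ?S e) = {N \<in> topspace ?X. models (free_group n Mod N) \<psi>}"
    unfolding models_surj_hom[OF carrier_Mod[symmetric]] using \<open>?A \<noteq> {}\<close> by blast
  finally show ?thesis .
qed

text \<open>\<open>group_equivalent\<close> only compares groups carried by subsets of
  \<open>nat\<close>. It transfers to the quotients because they are countable, being images of a
  set of words over a countable alphabet.\<close>

lemma closedin_models_universal:
  assumes "universal_sentence \<sigma>"
  shows "closedin (marked_group_space n)
    {N \<in> topspace (marked_group_space n). models (free_group n Mod N) \<sigma>}"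
proof -
  obtain xs \<psi> where \<psi>: "quantifier_free \<psi>" "sentence (foldr All xs \<psi>)"
      "group_equivalent \<sigma> (foldr All xs \<psi>)" and \<sigma>: "sentence \<sigma>"
    using assms by (auto simp: universal_sentence_def universal_prenex_def)
  have "models (free_group n Mod N) \<sigma> \<longleftrightarrow> models (free_group n Mod N) \<psi>"
    if "N \<in> topspace (marked_group_space n)" for N
  proof -
    interpret normal N "free_group n" using that by (simp add: topspace_marked_group_space)
    have "countable (carrier (free_group n Mod N))"
      unfolding carrier_Mod by (rule countable_image) (rule countableI_type)
    from models_equivalent_countable[OF \<psi>(3) \<sigma> \<psi>(2) factorgroup_is_group this]
    show ?thesis by (simp add: models_foldr_All)
  qed
  then show ?thesis
    using closedin_models_quantifier_free[OF \<psi>(1), of n] by (simp cong: conj_cong)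
qed

text \<open>If \<sigma> fails in the limit, the complement of its closed set of models is an open
  neighbourhood of the limit. Then \<sigma> fails in all \<open>Gs i\<close> from some
  \<open>k\<close> on, which contradicts the union over \<open>i \<ge> k\<close>.\<close>

lemma limsup_Univ_subset:
  assumes Gs: "\<And>i :: nat. marked_group n (Gs i) (Ss i)" and G: "marked_group n G S"
    and lim: "limitin (marked_group_space n) (\<lambda>i. marking_kernel (Gs i) (Ss i))
      (marking_kernel G S) sequentially"
  shows "(\<Inter>k. \<Union>i\<in>{k..}. Univ (Gs i)) \<subseteq> Univ G"
proof
  fix \<sigma> assume \<sigma>: "\<sigma> \<in> (\<Inter>k. \<Union>i\<in>{k..}. Univ (Gs i))"
  then have u: "universal_sentence \<sigma>" by (auto simp: Univ_def)
  then have s: "sentence \<sigma>" by (simp add: universal_sentence_def)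
  let ?X = "marked_group_space n"
  let ?C = "{N \<in> topspace ?X. models (free_group n Mod N) \<sigma>}"
  show "\<sigma> \<in> Univ G"
  proof (rule ccontr)
    assume "\<sigma> \<notin> Univ G"
    then have "marking_kernel G S \<in> topspace ?X - ?C"
      using u models_marking_kernel[OF G s] marking_kernel_in_space[OF G] by (auto simp: Univ_def)
    moreover have "openin ?X (topspace ?X - ?C)" using closedin_models_universal[OF u] by blast
    ultimately have "\<forall>\<^sub>F i in sequentially. marking_kernel (Gs i) (Ss i) \<in> topspace ?X - ?C"
      using lim unfolding limitin_def by blast
    then obtain k where "\<And>i. i \<ge> k \<Longrightarrow> \<not> models (Gs i) \<sigma>"
      using models_marking_kernel[OF Gs s] by (auto simp: eventually_sequentially)
    then show False using \<sigma> by (auto simp: Univ_def)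
  qed
qed

theorem proposition5p2:
  fixes n :: nat
  assumes "n > 0"
  shows
    "(\<forall>\<sigma>. universal_sentence \<sigma> \<longrightarrow>
        closedin (marked_group_space n)
          {N \<in> topspace (marked_group_space n). models (free_group n Mod N) \<sigma>})
   \<and> (\<forall>(Gs :: nat \<Rightarrow> ('a, 'b) monoid_scheme) Ss (G :: ('c, 'd) monoid_scheme) S.
        (\<forall>i. marked_group n (Gs i) (Ss i)) \<and> marked_group n G S \<and>
        limitin (marked_group_space n) (\<lambda>i. marking_kernel (Gs i) (Ss i))
          (marking_kernel G S) sequentially
        \<longrightarrow> (\<Inter>k. \<Union>i\<in>{k..}. Univ (Gs i)) \<subseteq> Univ G)"
proof (intro conjI allI impI; (elim conjE)?)
  fix \<sigma> assume "universal_sentence \<sigma>"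
  then show "closedin (marked_group_space n)
      {N \<in> topspace (marked_group_space n). models (free_group n Mod N) \<sigma>}"
    by (rule closedin_models_universal)
next
  fix Gs :: "nat \<Rightarrow> ('a, 'b) monoid_scheme" and Ss and G :: "('c, 'd) monoid_scheme" and S
  assume "\<forall>i. marked_group n (Gs i) (Ss i)" "marked_group n G S"
    "limitin (marked_group_space n) (\<lambda>i. marking_kernel (Gs i) (Ss i))
      (marking_kernel G S) sequentially"
  then show "(\<Inter>k. \<Union>i\<in>{k..}. Univ (Gs i)) \<subseteq> Univ G"
    by (intro limsup_Univ_subset[where n = n and Ss = Ss and S = S]) simp_all
qed

end
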